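(* Triples of side lengths of Sharygin triangles $ABC$ are all triples $(a,b,c)$ satisfying the equation $$q(a,b,c) = -c^3 - c^2(a+b) + c(a^2+ab+b^2) + (a^3+a^2b+ab^2+b^3) = 0$$ and the triangle inequalities $$0<a<b+c,\qquad 0<b<a+c,\qquad 0<c<a+b.$$
   Context: For a triangle $ABC$, write $a=BC$, $b=AC$, $c=AB$ for its side lengths, and let $AA'$, $BB'$, $CC'$ be its angle bisectors, where $A'$, $B'$, $C'$ are the points where the bisectors meet the opposite sides $BC$, $AC$, $AB$ respectively. The triangle $A'B'C'$ is called the bisectral triangle of $ABC$. A triangle is called a Sharygin triangle if it is scalene but its bisectral triangle is isosceles.
   Formalization: The condition a ≠ b is added, since (1, 1, (√17−1)/2) satisfies the equation and inequalities but is isosceles; the equation q(a,b,c)=0 is for the labelling with A'C' = B'C', and for arbitrary labelling it holds up to cyclic permutation of a, b, c. *)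

theory Defs
  imports "HOL-Analysis.Analysis"
begin

definition triangle :: "real^2 \<Rightarrow> real^2 \<Rightarrow> real^2 \<Rightarrow> bool" where
  "triangle A B C \<longleftrightarrow> \<not> collinear {A, B, C}"

definition side_lengths :: "real^2 \<Rightarrow> real^2 \<Rightarrow> real^2 \<Rightarrow> real \<times> real \<times> real" where
  "side_lengths A B C = (dist B C, dist A C, dist A B)"

definition scalene :: "real^2 \<Rightarrow> real^2 \<Rightarrow> real^2 \<Rightarrow> bool" where
  "scalene A B C \<longleftrightarrow> triangle A B C \<and>
     dist B C \<noteq> dist A C \<and> dist A C \<noteq> dist A B \<and> dist A B \<noteq> dist B C"

text \<open>Isosceles with apex at the first vertex.\<close>
definition isosceles_at :: "real^2 \<Rightarrow> real^2 \<Rightarrow> real^2 \<Rightarrow> bool" where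
  "isosceles_at P Q R \<longleftrightarrow> triangle P Q R \<and> dist P Q = dist P R"

definition isosceles :: "real^2 \<Rightarrow> real^2 \<Rightarrow> real^2 \<Rightarrow> bool" where
  "isosceles P Q R \<longleftrightarrow> isosceles_at P Q R \<or> isosceles_at Q R P \<or> isosceles_at R P Q"

text \<open>The unsigned angle at the middle point \<open>Q\<close>, with values in \<open>[0, \<pi>]\<close>.\<close>
definition angle :: "real^2 \<Rightarrow> real^2 \<Rightarrow> real^2 \<Rightarrow> real" where
  "angle P Q R = arccos (((P - Q) \<bullet> (R - Q)) / (norm (P - Q) * norm (R - Q)))"

text \<open>\<open>P\<close> is the point where the bisector of the angle at \<open>A\<close> meets the side \<open>BC\<close>.\<close>
definition bisector_foot :: "real^2 \<Rightarrow> real^2 \<Rightarrow> real^2 \<Rightarrow> real^2 \<Rightarrow> bool" where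
  "bisector_foot A B C P \<longleftrightarrow> P \<in> closed_segment B C \<and> angle B A P = angle P A C"

definition bisectral_triangle ::
    "real^2 \<Rightarrow> real^2 \<Rightarrow> real^2 \<Rightarrow> real^2 \<Rightarrow> real^2 \<Rightarrow> real^2 \<Rightarrow> bool" where
  "bisectral_triangle A B C A' B' C' \<longleftrightarrow>
     bisector_foot A B C A' \<and> bisector_foot B A C B' \<and> bisector_foot C A B C'"

definition sharygin :: "real^2 \<Rightarrow> real^2 \<Rightarrow> real^2 \<Rightarrow> bool" where
  "sharygin A B C \<longleftrightarrow> scalene A B C \<and>
     (\<exists>A' B' C'. bisectral_triangle A B C A' B' C' \<and> isosceles A' B' C')"

text \<open>A Sharygin triangle labelled so that \<open>A'C' = B'C'\<close>. This is the labelling under which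
  the side lengths satisfy the equation \<open>q(a, b, c) = 0\<close>, which is symmetric only in \<open>a\<close>
  and \<open>b\<close>; the other labellings give the cyclic permutations of that equation.\<close>
definition sharygin_at_C :: "real^2 \<Rightarrow> real^2 \<Rightarrow> real^2 \<Rightarrow> bool" where
  "sharygin_at_C A B C \<longleftrightarrow> scalene A B C \<and>
     (\<exists>A' B' C'. bisectral_triangle A B C A' B' C' \<and> isosceles_at C' A' B')"

definition q :: "real \<Rightarrow> real \<Rightarrow> real \<Rightarrow> real" where
  "q a b c = - (c^3) - c^2 * (a + b) + c * (a^2 + a*b + b^2) + (a^3 + a^2*b + a*b^2 + b^3)"

definition triangle_inequalities :: "real \<Rightarrow> real \<Rightarrow> real \<Rightarrow> bool" where
  "triangle_inequalities a b c \<longleftrightarrow>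
     0 < a \<and> a < b + c \<and> 0 < b \<and> b < a + c \<and> 0 < c \<and> c < a + b"

text \<open>The scalene condition does not follow from the equation: \<open>(1, 1, (\<surd>17 - 1)/2)\<close> satisfies
  \<open>q a b c = 0\<close> and the triangle inequalities, but belongs to an isosceles triangle. So a
  description of the Sharygin triples has to require \<open>a \<noteq> b\<close> in addition; then \<open>a \<noteq> c\<close> and
  \<open>b \<noteq> c\<close> are automatic, as \<open>q a b a = b * (a + b)^2\<close> and \<open>q a b b = a * (a + b)^2\<close>.\<close>

end

theory Submission
  imports Defs
begin

text \<open>The foot of a bisector divides the opposite side in the ratio of the adjacent sides, so
  \<open>A'\<close>, \<open>B'\<close>, \<open>C'\<close> have barycentric coordinates \<open>(0 : b : c)\<close>, \<open>(a : 0 : c)\<close>, \<open>(a : b : 0)\<close>;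
  in particular the bisectral triangle is never degenerate. Expressing \<open>A'C'\<close> and \<open>B'C'\<close>
  through the side lengths, the difference of their squares is a nonzero multiple of
  \<open>(a - b) * q a b c\<close>, so for \<open>a \<noteq> b\<close> the bisectral triangle has apex \<open>C'\<close> iff \<open>q a b c = 0\<close>.\<close>

section \<open>Cross product, nondegeneracy and strict triangle inequalities\<close>

definition cross2 :: "real^2 \<Rightarrow> real^2 \<Rightarrow> real" where
  "cross2 x y = x $ 1 * y $ 2 - x $ 2 * y $ 1"

text \<open>Lagrange's identity in the plane. It turns the equality case of Cauchy-Schwarz, and with
  it collinearity, into the vanishing of a polynomial in the coordinates.\<close>

lemma cross2_square: "(cross2 x y)^2 = (norm x * norm y)^2 - (x \<bullet> y)^2"
  unfolding cross2_def power_mult_distrib power2_norm_eq_inner inner_vec_def sum_2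
  by simp algebra

lemma triangle_iff_cross2: "triangle P Q R \<longleftrightarrow> cross2 (P - R) (Q - R) \<noteq> 0"
proof -
  have "collinear {P, Q, R} \<longleftrightarrow> collinear {P, R, Q}"
    by (simp add: insert_commute)
  also have "\<dots> \<longleftrightarrow> collinear {0, P - R, Q - R}"
    by (subst collinear_3) auto
  also have "\<dots> \<longleftrightarrow> ((P - R) \<bullet> (Q - R))^2 = (norm (P - R) * norm (Q - R))^2"
    unfolding norm_cauchy_schwarz_equal[symmetric]
    by (metis abs_mult abs_norm_cancel power2_eq_iff_nonneg abs_ge_zero power2_abs)
  also have "\<dots> \<longleftrightarrow> cross2 (P - R) (Q - R) = 0"
    using cross2_square[of "P - R" "Q - R"] by auto
  finally show ?thesis by (simp add: triangle_def)
qed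

lemma triangle_rotate: "triangle A B C \<longleftrightarrow> triangle B C A"
  by (simp add: triangle_def insert_commute)

lemma triangle_swap: "triangle A B C \<longleftrightarrow> triangle B A C"
  by (simp add: triangle_def insert_commute)

lemma triangle_imp_dist_pos:
  assumes "triangle A B C"
  shows "dist B C > 0" "dist A C > 0" "dist A B > 0"
  using assms by (auto simp: triangle_def insert_commute)

text \<open>Equality in the triangle inequality would put \<open>A\<close> between \<open>B\<close>
  and \<open>C\<close>.\<close>

lemma triangle_imp_dist_less:
  assumes "triangle A B C"
  shows "dist B C < dist A C + dist A B"
proof -
  have "\<not> between (B, C) A"
    using assms between_imp_collinear[of B C A]
    by (auto simp: triangle_def insert_commute)
  then show ?thesis
    using dist_triangle[of B C A] by (auto simp: between dist_commute)
qed

lemma triangle_imp_inequalities: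
  assumes "triangle A B C"
  shows "triangle_inequalities (dist B C) (dist A C) (dist A B)"
  using triangle_imp_dist_pos[OF assms] triangle_imp_dist_less[of A B C]
    triangle_imp_dist_less[of B C A] triangle_imp_dist_less[of C A B] assms
    triangle_rotate[of A B C] triangle_rotate[of C A B]
  by (auto simp: triangle_inequalities_def dist_commute)

section \<open>Angle bisector theorem\<close>

lemma angle_commute: "angle P Q R = angle R Q P"
  by (simp add: angle_def inner_commute mult.commute)

lemma bisector_foot_commute: "bisector_foot A B C P \<longleftrightarrow> bisector_foot A C B P"
  unfolding bisector_foot_def by (metis angle_commute closed_segment_commute)

text \<open>By Cauchy-Schwarz both cosines lie where \<open>arccos\<close> is injective, so the
  cosines themselves can be compared; the factor \<open>norm (P - A)\<close> then cancels.\<close>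

lemma angle_eq_iff_inner:
  assumes "B \<noteq> A" "P \<noteq> A" "C \<noteq> A"
  shows "angle B A P = angle P A C \<longleftrightarrow>
    ((B - A) \<bullet> (P - A)) * dist A C = ((P - A) \<bullet> (C - A)) * dist A B"
proof -
  have "\<bar>(x \<bullet> y) / (norm x * norm y)\<bar> \<le> 1" for x y :: "real^2"
    using Cauchy_Schwarz_ineq2[of x y]
    by (cases "x = 0 \<or> y = 0") (auto simp: divide_le_eq_1 abs_mult)
  then have "angle B A P = angle P A C \<longleftrightarrow>
      ((B - A) \<bullet> (P - A)) / (norm (B - A) * norm (P - A))
      = ((P - A) \<bullet> (C - A)) / (norm (P - A) * norm (C - A))"
    unfolding angle_def by (intro arccos_eq_iff) simp
  moreover have "norm (B - A) > 0" "norm (P - A) > 0" "norm (C - A) > 0"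
    using assms by auto
  ultimately show ?thesis
    by (simp add: dist_norm norm_minus_commute[of A] divide_simps ac_simps)
qed

lemma bisector_foot_iff:
  assumes "triangle A B C"
  shows "bisector_foot A B C P \<longleftrightarrow>
    P = (dist A C / (dist A C + dist A B)) *\<^sub>R B + (dist A B / (dist A C + dist A B)) *\<^sub>R C"
    (is "_ \<longleftrightarrow> P = ?F")
proof -
  define x y b c where "x = B - A" and "y = C - A" and "b = dist A C" and "c = dist A B"
  have bc: "b > 0" "c > 0" "norm x = c" "norm y = b"
    using triangle_imp_dist_pos[OF assms]
    by (auto simp: x_def y_def b_def c_def dist_norm norm_minus_commute)
  have "triangle B C A" using assms triangle_rotate by blast
  then have cr: "cross2 x y \<noteq> 0"
    by (simp add: triangle_iff_cross2 x_def y_def)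
  \<comment> \<open>Strict Cauchy-Schwarz for the independent vectors \<open>x\<close> and
    \<open>y\<close>; this is the factor to be cancelled below.\<close>
  then have ne: "c * b - x \<bullet> y \<noteq> 0"
    using cross2_square[of x y] bc by auto
  have foot: "angle B A P = angle P A C \<longleftrightarrow> t = c / (b + c)"
    if P: "P = (1 - t) *\<^sub>R B + t *\<^sub>R C" for t
  proof -
    have PA: "P - A = (1 - t) *\<^sub>R x + t *\<^sub>R y"
      by (simp add: P x_def y_def algebra_simps)
    \<comment> \<open>If \<open>P\<close> were \<open>A\<close>, both cross products would vanish,
      forcing \<open>t = 0\<close> and \<open>t = 1\<close> at once.\<close>
    have "cross2 x (P - A) = t * cross2 x y" "cross2 (P - A) y = (1 - t) * cross2 x y"
      by (simp_all add: PA cross2_def algebra_simps)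
    then have "P \<noteq> A" using cr by (auto simp: cross2_def)
    moreover have "B \<noteq> A" "C \<noteq> A" using bc by (auto simp: x_def y_def)
    ultimately have "angle B A P = angle P A C \<longleftrightarrow>
        (x \<bullet> (P - A)) * b = ((P - A) \<bullet> y) * c"
      by (simp add: angle_eq_iff_inner x_def y_def b_def c_def)
    \<comment> \<open>The condition is affine in \<open>t\<close> and splits off the nonzero factor
      \<open>c * b - x \<bullet> y\<close>, which leaves a single solution.\<close>
    also have "\<dots> \<longleftrightarrow> (c * b - x \<bullet> y) * ((1 - t) * c - t * b) = 0"
    proof -
      have "x \<bullet> x = c^2" "y \<bullet> y = b^2"
        using bc by (simp_all flip: power2_norm_eq_inner)
      then have "(x \<bullet> (P - A)) * b - ((P - A) \<bullet> y) * c
          = (c * b - x \<bullet> y) * ((1 - t) * c - t * b)"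
        unfolding PA by (simp add: inner_add inner_commute[of y x] algebra_simps power2_eq_square)
      then show ?thesis by (metis eq_iff_diff_eq_0)
    qed
    also have "\<dots> \<longleftrightarrow> t = c / (b + c)"
    proof -
      have "(1 - t) * c - t * b = 0 \<longleftrightarrow> t = c / (b + c)"
        using bc(1,2) by (auto simp: field_simps)
      then show ?thesis using ne by simp
    qed
    finally show ?thesis .
  qed
  have F: "?F = (1 - c / (b + c)) *\<^sub>R B + (c / (b + c)) *\<^sub>R C"
  proof -
    have "b / (b + c) = 1 - c / (b + c)" using bc(1,2) by (simp add: field_simps)
    then show ?thesis by (simp only: b_def c_def)
  qed
  \<comment> \<open>The solution lies in the unit interval, so it is a point of the closed
    segment.\<close>
  have "0 \<le> c / (b + c)" "c / (b + c) \<le> 1" using bc by auto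
  then show ?thesis
    unfolding bisector_foot_def in_segment F using foot by metis
qed

section \<open>Sides and area of the bisectral triangle\<close>

text \<open>Here \<open>p\<close> stands for the inner product of \<open>A - C\<close> and
  \<open>B - C\<close>, given by the law of cosines. Then \<open>d a b\<close> is the square of
  \<open>C'A'\<close>, and exchanging \<open>a\<close> and \<open>b\<close> gives that of
  \<open>C'B'\<close>.\<close>

lemma bisectral_identity:
  fixes a b c p :: real
  assumes "a > 0" "b > 0" "c > 0"
  assumes "2 * p = a^2 + b^2 - c^2"
  defines "d \<equiv> \<lambda>a b. (a * b / (a + b))^2 + (b * (1 / (a + b) - 1 / (b + c)))^2 * a^2
      + 2 * (a / (a + b)) * (b * (1 / (a + b) - 1 / (b + c))) * p"
  shows "d a b = d b a \<longleftrightarrow> (a - b) * q a b c = 0"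
proof -
  \<comment> \<open>The numerator of \<open>d a b\<close> over the denominator
    \<open>(a + b)^2 * (b + c)^2\<close>, with the factor \<open>a * b\<close> removed.\<close>
  define N where "N = (\<lambda>a b. a * b * (b + c)^2 + a * b * (c - a)^2 + (c - a) * (b + c) * (2 * p))"
  have d: "d a b = a * b * N a b / ((a + b)^2 * (b + c)^2)" if "a > 0" "b > 0" for a b
  proof -
    have "b * (1 / (a + b) - 1 / (b + c)) = b * (c - a) / ((a + b) * (b + c))"
      using that assms by (simp add: field_simps)
    moreover have "a / (a + b) = a * (b + c) / ((a + b) * (b + c))"
      "a * b / (a + b) = a * b * (b + c) / ((a + b) * (b + c))"
      using that assms by (simp_all add: add_pos_pos less_imp_neq[THEN not_sym])
    moreover have "b + c \<noteq> 0" using that assms by simp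
    ultimately have "d a b = (a * b * (b + c))^2 / ((a + b) * (b + c))^2
        + (b * (c - a))^2 * a^2 / ((a + b) * (b + c))^2
        + 2 * (a * (b + c)) * (b * (c - a)) * p / ((a + b) * (b + c))^2"
      unfolding d_def by (simp only: power_divide power2_eq_square times_divide_eq_left
          times_divide_eq_right divide_divide_eq_left)
    also have "\<dots> = a * b * N a b / ((a + b)^2 * (b + c)^2)"
      unfolding N_def power_mult_distrib add_divide_distrib[symmetric]
      by (rule arg_cong[where f = "\<lambda>x. x / _"]) algebra
    finally show ?thesis .
  qed
  \<comment> \<open>The factor \<open>a * b / (a + b)^2\<close> is symmetric in \<open>a\<close> and
    \<open>b\<close> and cancels.\<close>
  have "d a b = d b a \<longleftrightarrow> N a b * (a + c)^2 = N b a * (b + c)^2"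
  proof -
    have "d a b = a * b / (a + b)^2 * (N a b / (b + c)^2)"
      "d b a = a * b / (a + b)^2 * (N b a / (a + c)^2)"
      using assms(1,2) by (simp_all add: d add.commute[of b a])
    moreover have "a * b / (a + b)^2 \<noteq> 0" "(a + c)^2 \<noteq> 0" "(b + c)^2 \<noteq> 0"
      using assms(1-3) by auto
    ultimately show ?thesis by (simp only: mult_cancel_left frac_eq_eq simp_thms)
  qed
  also have "\<dots> \<longleftrightarrow> - c * (a + b) * ((a - b) * q a b c) = 0"
  proof -
    have "N a b * (a + c)^2 - N b a * (b + c)^2 = - c * (a + b) * ((a - b) * q a b c)"
      unfolding N_def assms(4) q_def by algebra
    then show ?thesis by (metis eq_iff_diff_eq_0)
  qed
  finally show ?thesis using assms(1-3) by simp
qed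

lemma norm_lincomb_square:
  fixes x y :: "'a::real_inner"
  shows "(norm (s *\<^sub>R x + t *\<^sub>R y))^2
    = s^2 * (norm x)^2 + t^2 * (norm y)^2 + 2 * s * t * (x \<bullet> y)"
  unfolding power2_norm_eq_inner
  by (simp add: inner_add inner_commute[of y x] power2_eq_square algebra_simps)

lemma isosceles_at_foot_iff:
  assumes "triangle A B C" "bisectral_triangle A B C A' B' C'"
  defines "a \<equiv> dist B C" and "b \<equiv> dist A C" and "c \<equiv> dist A B"
  shows "isosceles_at C' A' B' \<longleftrightarrow> (a - b) * q a b c = 0"
proof -
  have pos: "a > 0" "b > 0" "c > 0"
    using triangle_imp_dist_pos[OF assms(1)] by (auto simp: a_def b_def c_def)
  have tri: "triangle B A C" "triangle C A B"
    using assms(1) triangle_rotate triangle_swap by blast+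
  have A': "A' = (b / (b + c)) *\<^sub>R B + (c / (b + c)) *\<^sub>R C"
    and B': "B' = (a / (a + c)) *\<^sub>R A + (c / (a + c)) *\<^sub>R C"
    and C': "C' = (a / (a + b)) *\<^sub>R A + (b / (a + b)) *\<^sub>R B"
    using assms(2) bisector_foot_iff[OF assms(1)] bisector_foot_iff[OF tri(1)]
      bisector_foot_iff[OF tri(2)]
    by (auto simp: bisectral_triangle_def a_def b_def c_def dist_commute)
  define x y where "x = A - C" and "y = B - C"
  have nxy: "norm x = b" "norm y = a"
    by (auto simp: x_def y_def a_def b_def dist_norm)
  have A'C: "A' = C + (b / (b + c)) *\<^sub>R y"
  proof -
    have "c / (b + c) = 1 - b / (b + c)" using pos by (simp add: field_simps)
    then show ?thesis unfolding A' y_def by (simp only:) (simp add: algebra_simps)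
  qed
  have B'C: "B' = C + (a / (a + c)) *\<^sub>R x"
  proof -
    have "c / (a + c) = 1 - a / (a + c)" using pos by (simp add: field_simps)
    then show ?thesis unfolding B' x_def by (simp only:) (simp add: algebra_simps)
  qed
  have C'C: "C' = C + (a / (a + b)) *\<^sub>R x + (b / (a + b)) *\<^sub>R y"
  proof -
    have "a / (a + b) + b / (a + b) = 1"
      using pos by (simp flip: add_divide_distrib)
    then have "(a / (a + b)) *\<^sub>R C + (b / (a + b)) *\<^sub>R C = C"
      by (simp flip: scaleR_add_left)
    then show ?thesis by (simp add: C' x_def y_def algebra_simps)
  qed
  have "triangle C' A' B'"
  proof -
    have "cross2 x y \<noteq> 0"
      using assms(1) by (simp add: triangle_iff_cross2 x_def y_def)
    \<comment> \<open>The coefficient is the ratio of the area of the bisectral triangle to that of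
      \<open>ABC\<close>; it is positive.\<close>
    moreover have "cross2 (A' - C') (B' - C')
        = 2 * a * b * c / ((a + b) * (b + c) * (a + c)) * cross2 x y"
    proof -
      have comb: "cross2 (s *\<^sub>R x + t *\<^sub>R y) (u *\<^sub>R x + v *\<^sub>R y) = (s * v - t * u) * cross2 x y"
        for s t u v by (simp add: cross2_def algebra_simps)
      have "A' - C' = (- (a / (a + b))) *\<^sub>R x + (b / (b + c) - b / (a + b)) *\<^sub>R y"
        "B' - C' = (a / (a + c) - a / (a + b)) *\<^sub>R x + (- (b / (a + b))) *\<^sub>R y"
        by (simp_all add: A'C B'C C'C algebra_simps)
      moreover have "(- (a / (a + b))) * (- (b / (a + b)))
          - (b / (b + c) - b / (a + b)) * (a / (a + c) - a / (a + b))
          = 2 * a * b * c / ((a + b) * (b + c) * (a + c))"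
      proof -
        have nz: "a + b \<noteq> 0" "b + c \<noteq> 0" "a + c \<noteq> 0" using pos by auto
        show ?thesis using nz by (simp add: divide_simps) algebra
      qed
      ultimately show ?thesis by (simp only: comb)
    qed
    ultimately have "cross2 (A' - C') (B' - C') \<noteq> 0" using pos by simp
    then have "triangle A' B' C'" by (simp add: triangle_iff_cross2)
    then show ?thesis using triangle_rotate by blast
  qed
  moreover have "dist C' A' = dist C' B' \<longleftrightarrow> (a - b) * q a b c = 0"
  proof -
    have "c = norm (x - y)" by (simp add: c_def x_def y_def dist_norm)
    then have "c^2 = b^2 + a^2 - 2 * (x \<bullet> y)"
      using norm_lincomb_square[of 1 x "-1" y] by (simp add: nxy)
    then have p: "2 * (x \<bullet> y) = a^2 + b^2 - c^2" by simp
    have "C' - A' = (a / (a + b)) *\<^sub>R x + (b * (1 / (a + b) - 1 / (b + c))) *\<^sub>R y"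
      by (simp add: A'C C'C algebra_simps)
    then have CA: "(dist C' A')^2 = (a * b / (a + b))^2
        + (b * (1 / (a + b) - 1 / (b + c)))^2 * a^2
        + 2 * (a / (a + b)) * (b * (1 / (a + b) - 1 / (b + c))) * (x \<bullet> y)"
      by (simp add: dist_norm norm_lincomb_square nxy power_mult_distrib power_divide)
    \<comment> \<open>Listing \<open>y\<close> before \<open>x\<close> makes this the previous
      expansion with \<open>a\<close>, \<open>b\<close> and \<open>x\<close>, \<open>y\<close>
      exchanged, matching \<open>d b a\<close>.\<close>
    have "C' - B' = (b / (a + b)) *\<^sub>R y + (a * (1 / (a + b) - 1 / (a + c))) *\<^sub>R x"
      by (simp add: B'C C'C algebra_simps)
    then have CB: "(dist C' B')^2 = (b * a / (b + a))^2
        + (a * (1 / (b + a) - 1 / (a + c)))^2 * b^2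
        + 2 * (b / (b + a)) * (a * (1 / (b + a) - 1 / (a + c))) * (x \<bullet> y)"
      by (simp add: dist_norm norm_lincomb_square nxy power_mult_distrib power_divide
          inner_commute[of y x] add.commute[of b a])
    have "dist C' A' = dist C' B' \<longleftrightarrow> (dist C' A')^2 = (dist C' B')^2"
      by simp
    then show ?thesis
      using bisectral_identity[OF pos p] by (simp only: CA CB)
  qed
  ultimately show ?thesis by (simp add: isosceles_at_def)
qed

section \<open>Choice of the apex\<close>

lemma bisectral_triangle_exists:
  assumes "triangle A B C"
  shows "\<exists>A' B' C'. bisectral_triangle A B C A' B' C'"
  using assms triangle_rotate triangle_swap
  unfolding bisectral_triangle_def by (metis bisector_foot_iff)

text \<open>The criterion holds for any feet of the bisectors, and feet exist; scalenity cancels the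
  factor \<open>a - b\<close>.\<close>

lemma sharygin_at_C_iff:
  "sharygin_at_C A B C \<longleftrightarrow> scalene A B C \<and> q (dist B C) (dist A C) (dist A B) = 0"
proof (cases "scalene A B C")
  case True
  then have "triangle A B C" "dist B C \<noteq> dist A C" by (auto simp: scalene_def)
  then show ?thesis
    unfolding sharygin_at_C_def
    using isosceles_at_foot_iff bisectral_triangle_exists by fastforce
qed (simp add: sharygin_at_C_def)

lemma bisectral_triangle_rotate:
  "bisectral_triangle A B C A' B' C' \<longleftrightarrow> bisectral_triangle B C A B' C' A'"
  unfolding bisectral_triangle_def by (metis bisector_foot_commute)

lemma scalene_rotate: "scalene A B C \<longleftrightarrow> scalene B C A"
  unfolding scalene_def by (metis triangle_rotate dist_commute)

text \<open>Any of the three vertices may be the apex; a cyclic relabelling moves it to the third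
  place.\<close>

lemma sharygin_iff:
  "sharygin A B C \<longleftrightarrow> sharygin_at_C A B C \<or> sharygin_at_C B C A \<or> sharygin_at_C C A B"
proof -
  have "scalene C A B \<longleftrightarrow> scalene A B C" "scalene B C A \<longleftrightarrow> scalene A B C"
    using scalene_rotate by blast+
  moreover have "bisectral_triangle C A B C' A' B' \<longleftrightarrow> bisectral_triangle A B C A' B' C'"
    "bisectral_triangle B C A B' C' A' \<longleftrightarrow> bisectral_triangle A B C A' B' C'" for A' B' C'
    using bisectral_triangle_rotate by blast+
  ultimately show ?thesis
    unfolding sharygin_def sharygin_at_C_def isosceles_def by metis
qed

section \<open>Triangles with prescribed sides\<close>

lemma triangle_with_sides_exists:
  assumes "triangle_inequalities a b c"
  obtains A B C where "triangle A B C" "dist B C = a" "dist A C = b" "dist A B = c"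
proof -
  have pos: "a > 0" "b > 0" "c > 0" and tri: "a < b + c" "b < a + c" "c < a + b"
    using assms by (auto simp: triangle_inequalities_def)
  \<comment> \<open>With \<open>C\<close> at the origin and \<open>B\<close> on the first axis,
    \<open>u\<close> is the first coordinate of \<open>A\<close> by the law of cosines, and
    \<open>h\<close> is the altitude from \<open>A\<close>.\<close>
  define u where "u = (a^2 + b^2 - c^2) / (2 * a)"
  define h where "h = sqrt (b^2 - u^2)"
  \<comment> \<open>Heron's factorization: the strict triangle inequalities make every factor
    positive, so \<open>h\<close> is the root of a positive number.\<close>
  have "(2 * a * b)^2 - (a^2 + b^2 - c^2)^2
      = (a + b + c) * (a + b - c) * (c + a - b) * (b + c - a)" by algebra
  also have "\<dots> > 0" using pos tri by simp
  finally have "u^2 < b^2"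
    using pos by (simp add: u_def power_divide power_mult_distrib field_simps)
  then have h: "h > 0" "h^2 = b^2 - u^2" by (simp_all add: h_def)
  have ua: "2 * a * u = a^2 + b^2 - c^2" using pos by (simp add: u_def)
  define A B C :: "real^2" where "A = vector [u, h]" and "B = vector [a, 0]" and "C = 0"
  have norm2: "norm z = sqrt ((z $ 1)^2 + (z $ 2)^2)" for z :: "real^2"
    by (simp add: norm_vec_def L2_set_def sum_2)
  have "triangle A B C"
    using pos h by (simp add: triangle_iff_cross2 cross2_def A_def B_def C_def)
  moreover have "dist B C = a" "dist A C = b"
    using pos h by (simp_all add: dist_norm norm2 A_def B_def C_def)
  moreover have "dist A B = c"
  proof -
    have "(u - a)^2 + h^2 = c^2" using h ua by algebra
    then show ?thesis using pos by (simp add: dist_norm norm2 A_def B_def)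
  qed
  ultimately show ?thesis using that by blast
qed

section \<open>Sets of side triples\<close>

lemma q_eq_0_imp_distinct:
  assumes "q a b c = 0" "triangle_inequalities a b c"
  shows "b \<noteq> c" "c \<noteq> a"
proof -
  have "q a b a = b * (a + b)^2" "q a b b = a * (a + b)^2"
    unfolding q_def by algebra+
  then show "b \<noteq> c" "c \<noteq> a"
    using assms by (auto simp: triangle_inequalities_def)
qed

text \<open>Every admissible triple is realized by some triangle, so a property that depends on the
  sides alone can be read off from its triples. Both halves of the theorem are instances.\<close>

lemma side_lengths_eq_iff:
  assumes "\<And>A B C. P A B C \<longleftrightarrow>
    triangle A B C \<and> R (dist B C) (dist A C) (dist A B)"
  shows "{side_lengths A B C | A B C. P A B C}
    = {(a, b, c). triangle_inequalities a b c \<and> R a b c}"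
proof (intro equalityI subsetI)
  fix s assume "s \<in> {side_lengths A B C | A B C. P A B C}"
  then show "s \<in> {(a, b, c). triangle_inequalities a b c \<and> R a b c}"
    using triangle_imp_inequalities by (auto simp: side_lengths_def assms)
next
  fix s assume "s \<in> {(a, b, c). triangle_inequalities a b c \<and> R a b c}"
  then obtain a b c where s: "s = (a, b, c)" "triangle_inequalities a b c" "R a b c"
    by auto
  from triangle_with_sides_exists[OF s(2)] obtain A B C where
    "triangle A B C" "dist B C = a" "dist A C = b" "dist A B = c" .
  with s show "s \<in> {side_lengths A B C | A B C. P A B C}"
    by (force simp: side_lengths_def assms)
qed

lemma sharygin_at_C_iff_sides:
  "sharygin_at_C A B C \<longleftrightarrow> triangle A B C \<and>
    q (dist B C) (dist A C) (dist A B) = 0 \<and> dist B C \<noteq> dist A C"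
  unfolding sharygin_at_C_iff scalene_def
  using q_eq_0_imp_distinct triangle_imp_inequalities by metis

text \<open>Rotating the vertices rotates the triple of sides, which produces the cyclic
  permutations of the equation.\<close>

lemma sharygin_iff_sides:
  "sharygin A B C \<longleftrightarrow> triangle A B C \<and>
    (let a = dist B C; b = dist A C; c = dist A B in
      q a b c = 0 \<and> a \<noteq> b \<or> q b c a = 0 \<and> b \<noteq> c \<or> q c a b = 0 \<and> c \<noteq> a)"
  unfolding sharygin_iff sharygin_at_C_iff_sides Let_def
  by (metis triangle_rotate dist_commute)

theorem proposition3p1:
  shows "{side_lengths A B C | A B C. sharygin_at_C A B C}
           = {(a, b, c). q a b c = 0 \<and> triangle_inequalities a b c \<and> a \<noteq> b}
       \<and> {side_lengths A B C | A B C. sharygin A B C}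
           = {(a, b, c). triangle_inequalities a b c \<and>
               (q a b c = 0 \<and> a \<noteq> b \<or> q b c a = 0 \<and> b \<noteq> c \<or> q c a b = 0 \<and> c \<noteq> a)}"
  using side_lengths_eq_iff[where P = sharygin_at_C, OF sharygin_at_C_iff_sides]
    side_lengths_eq_iff[where P = sharygin, OF sharygin_iff_sides[unfolded Let_def]]
  by auto

end
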